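(* Let $M\xrightarrow{P}A$ be a relative averaging algebra and $(N\xrightarrow{Q}B,l,r)$ a bimodule over it. Then the vector space $N$ carries a representation of the induced diassociative algebra $M_P$ with action maps, for $u\in M$, $n\in N$, $$u\dashv n=l(u,Q(n)),\quad u\vdash n=P(u)\cdot_Nn,\quad n\dashv u=n\cdot_NP(u),\quad n\vdash u=r(Q(n),u).$$
   Context: Vector spaces are over a field of characteristic $0$; associative algebras are not assumed unital. A relative averaging algebra $M\xrightarrow{P}A$ consists of an associative algebra $A$, an $A$-bimodule $M$ (both actions written $\cdot_M$) and a linear map $P:M\to A$ with $P(u)\cdot P(v)=P(P(u)\cdot_Mv)=P(u\cdot_MP(v))$ for all $u,v\in M$. A bimodule over $M\xrightarrow{P}A$ is a tuple $(N\xrightarrow{Q}B,l,r)$ where $N,B$ are $A$-bimodules, $Q:N\to B$ is a linear map, and $l:M\times B\to N$, $r:B\times M\to N$ are bilinear maps such that for $a\in A,b\in B,u\in M,n\in N$: $l(a\cdot_Mu,b)=a\cdot_Nl(u,b)$, $l(u\cdot_Ma,b)=l(u,a\cdot_Bb)$, $l(u,b\cdot_Ba)=l(u,b)\cdot_Na$; $r(a\cdot_Bb,u)=a\cdot_Nr(b,u)$, $r(b\cdot_Ba,u)=r(b,a\cdot_Mu)$, $r(b,u\cdot_Ma)=r(b,u)\cdot_Na$; $P(u)\cdot_BQ(n)=Q(P(u)\cdot_Nn)=Q(l(u,Q(n)))$; $Q(n)\cdot_BP(u)=Q(r(Q(n),u))=Q(n\cdot_NP(u))$. A diassociative algebra is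 a vector space $D$ with bilinear operations $\dashv,\vdash$ satisfying the five identities $(a\dashv b)\dashv c=a\dashv(b\dashv c)=a\dashv(b\vdash c)$, $(a\vdash b)\dashv c=a\vdash(b\dashv c)$, $(a\dashv b)\vdash c=(a\vdash b)\vdash c=a\vdash(b\vdash c)$. A representation of $D$ is a vector space $V$ with four bilinear maps $\dashv,\vdash:D\times V\to V$ and $\dashv,\vdash:V\times D\to V$ satisfying the fifteen identities obtained from the five above by taking exactly one of $a,b,c$ in $V$ and the other two in $D$. $M_P$ is the diassociative algebra $M$ with $u\dashv_Pv=u\cdot_MP(v)$, $u\vdash_Pv=P(u)\cdot_Mv$. *)

theory Defs
  imports Complex_Main
begin

text \<open>
  A vector space is a type \<open>'v :: ab_group_add\<close> together with a scalar multiplication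
  \<open>s :: 'k \<Rightarrow> 'v \<Rightarrow> 'v\<close> satisfying \<^locale>\<open>vector_space\<close>, over a field \<open>'k :: field_char_0\<close>.
  Associative algebras need not have a unit, so no axiom on the action of a unit
  appears in the definition of a bimodule.
\<close>

definition bilinear_map ::
  "('k :: field_char_0 \<Rightarrow> 'u \<Rightarrow> 'u) \<Rightarrow> ('k \<Rightarrow> 'v \<Rightarrow> 'v) \<Rightarrow> ('k \<Rightarrow> 'w \<Rightarrow> 'w) \<Rightarrow>
   ('u :: ab_group_add \<Rightarrow> 'v :: ab_group_add \<Rightarrow> 'w :: ab_group_add) \<Rightarrow> bool" where
  "bilinear_map sU sV sW f \<longleftrightarrow>
     (\<forall>u. Vector_Spaces.linear sV sW (\<lambda>v. f u v)) \<and>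
     (\<forall>v. Vector_Spaces.linear sU sW (\<lambda>u. f u v))"

locale assoc_algebra =
  vs: vector_space sA
  for sA :: "'k :: field_char_0 \<Rightarrow> 'a :: ab_group_add \<Rightarrow> 'a" +
  fixes mul :: "'a \<Rightarrow> 'a \<Rightarrow> 'a"  (infixl "\<cdot>" 70)
  assumes bilinear_mul: "bilinear_map sA sA sA (\<cdot>)"
    and mul_assoc: "(a \<cdot> b) \<cdot> c = a \<cdot> (b \<cdot> c)"

locale algebra_bimodule =
  alg: assoc_algebra sA mul + mod: vector_space sM
  for sA :: "'k :: field_char_0 \<Rightarrow> 'a :: ab_group_add \<Rightarrow> 'a"
    and mul :: "'a \<Rightarrow> 'a \<Rightarrow> 'a"  (infixl "\<cdot>" 70)
    and sM :: "'k \<Rightarrow> 'm :: ab_group_add \<Rightarrow> 'm" +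
  fixes lact :: "'a \<Rightarrow> 'm \<Rightarrow> 'm"  (infixr "\<rhd>" 70)
    and ract :: "'m \<Rightarrow> 'a \<Rightarrow> 'm"  (infixl "\<lhd>" 70)
  assumes bilinear_lact: "bilinear_map sA sM sM (\<rhd>)"
    and bilinear_ract: "bilinear_map sM sA sM (\<lhd>)"
    and lact_mul: "(a \<cdot> b) \<rhd> m = a \<rhd> (b \<rhd> m)"
    and lact_ract: "(a \<rhd> m) \<lhd> b = a \<rhd> (m \<lhd> b)"
    and ract_mul: "(m \<lhd> a) \<lhd> b = m \<lhd> (a \<cdot> b)"

locale rel_averaging_algebra =
  algebra_bimodule sA mulA sM lM rM
  for sA :: "'k :: field_char_0 \<Rightarrow> 'a :: ab_group_add \<Rightarrow> 'a"
    and mulA :: "'a \<Rightarrow> 'a \<Rightarrow> 'a"  (infixl "\<cdot>" 70)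
    and sM :: "'k \<Rightarrow> 'm :: ab_group_add \<Rightarrow> 'm"
    and lM :: "'a \<Rightarrow> 'm \<Rightarrow> 'm"  (infixr "\<rhd>\<^sub>M" 70)
    and rM :: "'m \<Rightarrow> 'a \<Rightarrow> 'm"  (infixl "\<lhd>\<^sub>M" 70) +
  fixes P :: "'m \<Rightarrow> 'a"
  assumes linear_P: "Vector_Spaces.linear sM sA P"
    and averaging_left: "P u \<cdot> P v = P (P u \<rhd>\<^sub>M v)"
    and averaging_right: "P u \<cdot> P v = P (u \<lhd>\<^sub>M P v)"

locale rel_averaging_bimodule =
  base: rel_averaging_algebra sA mulA sM lM rM P +
  N: algebra_bimodule sA mulA sN lN rN +
  B: algebra_bimodule sA mulA sB lB rB
  for sA :: "'k :: field_char_0 \<Rightarrow> 'a :: ab_group_add \<Rightarrow> 'a"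
    and mulA :: "'a \<Rightarrow> 'a \<Rightarrow> 'a"  (infixl "\<cdot>" 70)
    and sM :: "'k \<Rightarrow> 'm :: ab_group_add \<Rightarrow> 'm"
    and lM :: "'a \<Rightarrow> 'm \<Rightarrow> 'm"  (infixr "\<rhd>\<^sub>M" 70)
    and rM :: "'m \<Rightarrow> 'a \<Rightarrow> 'm"  (infixl "\<lhd>\<^sub>M" 70)
    and P :: "'m \<Rightarrow> 'a"
    and sN :: "'k \<Rightarrow> 'n :: ab_group_add \<Rightarrow> 'n"
    and lN :: "'a \<Rightarrow> 'n \<Rightarrow> 'n"  (infixr "\<rhd>\<^sub>N" 70)
    and rN :: "'n \<Rightarrow> 'a \<Rightarrow> 'n"  (infixl "\<lhd>\<^sub>N" 70)
    and sB :: "'k \<Rightarrow> 'b :: ab_group_add \<Rightarrow> 'b"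
    and lB :: "'a \<Rightarrow> 'b \<Rightarrow> 'b"  (infixr "\<rhd>\<^sub>B" 70)
    and rB :: "'b \<Rightarrow> 'a \<Rightarrow> 'b"  (infixl "\<lhd>\<^sub>B" 70) +
  fixes Q :: "'n \<Rightarrow> 'b"
    and l :: "'m \<Rightarrow> 'b \<Rightarrow> 'n"
    and r :: "'b \<Rightarrow> 'm \<Rightarrow> 'n"
  assumes linear_Q: "Vector_Spaces.linear sN sB Q"
    and bilinear_l: "bilinear_map sM sB sN l"
    and bilinear_r: "bilinear_map sB sM sN r"
    and l_lact: "l (a \<rhd>\<^sub>M u) b = a \<rhd>\<^sub>N l u b"
    and l_mid: "l (u \<lhd>\<^sub>M a) b = l u (a \<rhd>\<^sub>B b)"
    and l_ract: "l u (b \<lhd>\<^sub>B a) = l u b \<lhd>\<^sub>N a"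
    and r_lact: "r (a \<rhd>\<^sub>B b) u = a \<rhd>\<^sub>N r b u"
    and r_mid: "r (b \<lhd>\<^sub>B a) u = r b (a \<rhd>\<^sub>M u)"
    and r_ract: "r b (u \<lhd>\<^sub>M a) = r b u \<lhd>\<^sub>N a"
    and P_Q_lact: "P u \<rhd>\<^sub>B Q n = Q (P u \<rhd>\<^sub>N n)"
    and P_Q_l: "P u \<rhd>\<^sub>B Q n = Q (l u (Q n))"
    and Q_P_r: "Q n \<lhd>\<^sub>B P u = Q (r (Q n) u)"
    and Q_P_ract: "Q n \<lhd>\<^sub>B P u = Q (n \<lhd>\<^sub>N P u)"

locale diassoc_algebra =
  vs: vector_space sD
  for sD :: "'k :: field_char_0 \<Rightarrow> 'd :: ab_group_add \<Rightarrow> 'd" +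
  fixes dl :: "'d \<Rightarrow> 'd \<Rightarrow> 'd"  (infixl "\<stileturn>" 70)
    and dr :: "'d \<Rightarrow> 'd \<Rightarrow> 'd"  (infixl "\<turnstile>" 70)
  assumes bilinear_dl: "bilinear_map sD sD sD (\<stileturn>)"
    and bilinear_dr: "bilinear_map sD sD sD (\<turnstile>)"
    and dl_dl: "(a \<stileturn> b) \<stileturn> c = a \<stileturn> (b \<stileturn> c)"
    and dl_bar: "a \<stileturn> (b \<stileturn> c) = a \<stileturn> (b \<turnstile> c)"
    and dr_dl: "(a \<turnstile> b) \<stileturn> c = a \<turnstile> (b \<stileturn> c)"
    and dr_bar: "(a \<stileturn> b) \<turnstile> c = (a \<turnstile> b) \<turnstile> c"
    and dr_dr: "(a \<turnstile> b) \<turnstile> c = a \<turnstile> (b \<turnstile> c)"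

text \<open>
  The subscripts \<open>DV\<close> and \<open>VD\<close> mark the actions \<open>D \<times> V \<rightarrow> V\<close> and \<open>V \<times> D \<rightarrow> V\<close>.
  The suffixes \<open>_1\<close>, \<open>_2\<close>, \<open>_3\<close> of the axiom names give the position
  of the argument taken from \<open>V\<close>.
\<close>

locale diassoc_representation =
  D: diassoc_algebra sD dl dr + rep: vector_space sV
  for sD :: "'k :: field_char_0 \<Rightarrow> 'd :: ab_group_add \<Rightarrow> 'd"
    and dl :: "'d \<Rightarrow> 'd \<Rightarrow> 'd"  (infixl "\<stileturn>" 70)
    and dr :: "'d \<Rightarrow> 'd \<Rightarrow> 'd"  (infixl "\<turnstile>" 70)
    and sV :: "'k \<Rightarrow> 'v :: ab_group_add \<Rightarrow> 'v" +
  fixes dl_DV :: "'d \<Rightarrow> 'v \<Rightarrow> 'v"  (infixl "\<stileturn>\<^sub>D\<^sub>V" 70)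
    and dr_DV :: "'d \<Rightarrow> 'v \<Rightarrow> 'v"  (infixl "\<turnstile>\<^sub>D\<^sub>V" 70)
    and dl_VD :: "'v \<Rightarrow> 'd \<Rightarrow> 'v"  (infixl "\<stileturn>\<^sub>V\<^sub>D" 70)
    and dr_VD :: "'v \<Rightarrow> 'd \<Rightarrow> 'v"  (infixl "\<turnstile>\<^sub>V\<^sub>D" 70)
  assumes bilinear_dl_DV: "bilinear_map sD sV sV (\<stileturn>\<^sub>D\<^sub>V)"
    and bilinear_dr_DV: "bilinear_map sD sV sV (\<turnstile>\<^sub>D\<^sub>V)"
    and bilinear_dl_VD: "bilinear_map sV sD sV (\<stileturn>\<^sub>V\<^sub>D)"
    and bilinear_dr_VD: "bilinear_map sV sD sV (\<turnstile>\<^sub>V\<^sub>D)"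
    and dl_dl_1: "(x \<stileturn>\<^sub>V\<^sub>D b) \<stileturn>\<^sub>V\<^sub>D c = x \<stileturn>\<^sub>V\<^sub>D (b \<stileturn> c)"
    and dl_bar_1: "x \<stileturn>\<^sub>V\<^sub>D (b \<stileturn> c) = x \<stileturn>\<^sub>V\<^sub>D (b \<turnstile> c)"
    and dr_dl_1: "(x \<turnstile>\<^sub>V\<^sub>D b) \<stileturn>\<^sub>V\<^sub>D c = x \<turnstile>\<^sub>V\<^sub>D (b \<stileturn> c)"
    and dr_bar_1: "(x \<stileturn>\<^sub>V\<^sub>D b) \<turnstile>\<^sub>V\<^sub>D c = (x \<turnstile>\<^sub>V\<^sub>D b) \<turnstile>\<^sub>V\<^sub>D c"
    and dr_dr_1: "(x \<turnstile>\<^sub>V\<^sub>D b) \<turnstile>\<^sub>V\<^sub>D c = x \<turnstile>\<^sub>V\<^sub>D (b \<turnstile> c)"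
    and dl_dl_2: "(a \<stileturn>\<^sub>D\<^sub>V x) \<stileturn>\<^sub>V\<^sub>D c = a \<stileturn>\<^sub>D\<^sub>V (x \<stileturn>\<^sub>V\<^sub>D c)"
    and dl_bar_2: "a \<stileturn>\<^sub>D\<^sub>V (x \<stileturn>\<^sub>V\<^sub>D c) = a \<stileturn>\<^sub>D\<^sub>V (x \<turnstile>\<^sub>V\<^sub>D c)"
    and dr_dl_2: "(a \<turnstile>\<^sub>D\<^sub>V x) \<stileturn>\<^sub>V\<^sub>D c = a \<turnstile>\<^sub>D\<^sub>V (x \<stileturn>\<^sub>V\<^sub>D c)"
    and dr_bar_2: "(a \<stileturn>\<^sub>D\<^sub>V x) \<turnstile>\<^sub>V\<^sub>D c = (a \<turnstile>\<^sub>D\<^sub>V x) \<turnstile>\<^sub>V\<^sub>D c"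
    and dr_dr_2: "(a \<turnstile>\<^sub>D\<^sub>V x) \<turnstile>\<^sub>V\<^sub>D c = a \<turnstile>\<^sub>D\<^sub>V (x \<turnstile>\<^sub>V\<^sub>D c)"
    and dl_dl_3: "(a \<stileturn> b) \<stileturn>\<^sub>D\<^sub>V x = a \<stileturn>\<^sub>D\<^sub>V (b \<stileturn>\<^sub>D\<^sub>V x)"
    and dl_bar_3: "a \<stileturn>\<^sub>D\<^sub>V (b \<stileturn>\<^sub>D\<^sub>V x) = a \<stileturn>\<^sub>D\<^sub>V (b \<turnstile>\<^sub>D\<^sub>V x)"
    and dr_dl_3: "(a \<turnstile> b) \<stileturn>\<^sub>D\<^sub>V x = a \<turnstile>\<^sub>D\<^sub>V (b \<stileturn>\<^sub>D\<^sub>V x)"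
    and dr_bar_3: "(a \<stileturn> b) \<turnstile>\<^sub>D\<^sub>V x = (a \<turnstile> b) \<turnstile>\<^sub>D\<^sub>V x"
    and dr_dr_3: "(a \<turnstile> b) \<turnstile>\<^sub>D\<^sub>V x = a \<turnstile>\<^sub>D\<^sub>V (b \<turnstile>\<^sub>D\<^sub>V x)"

text \<open>
  The operations \<open>u \<stileturn>\<^sub>P v = u \<cdot>\<^sub>M P v\<close> and \<open>u \<turnstile>\<^sub>P v = P u \<cdot>\<^sub>M v\<close> of the induced
  diassociative algebra \<open>M\<^sub>P\<close>: the first uses the right action on \<open>M\<close>, the second the left action.
\<close>

definition induced_dl :: "('m \<Rightarrow> 'a \<Rightarrow> 'm) \<Rightarrow> ('m \<Rightarrow> 'a) \<Rightarrow> 'm \<Rightarrow> 'm \<Rightarrow> 'm" where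
  "induced_dl rM P u v = rM u (P v)"

definition induced_dr :: "('a \<Rightarrow> 'm \<Rightarrow> 'm) \<Rightarrow> ('m \<Rightarrow> 'a) \<Rightarrow> 'm \<Rightarrow> 'm \<Rightarrow> 'm" where
  "induced_dr lM P u v = lM (P u) v"

end

theory Submission
  imports Defs
begin

text \<open>The map \<open>P\<close> sends both products of u and v in the induced algebra to
  P(u)P(v). Likewise \<open>Q\<close> sends both left actions of u on n to the action of P(u) on
  Q(n) in B, and both right actions to that of P(u) on the other side. Once \<open>P\<close> and
  \<open>Q\<close> are pushed inward in this way, each identity becomes one of the associativity
  laws of the bimodules or a compatibility law of \<open>l\<close> and \<open>r\<close>. Bilinearity
  holds because every operation is a given bilinear map with \<open>P\<close> or \<open>Q\<close>
  inserted in one argument.\<close>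

lemma bilinear_map_comp_left:
  assumes "bilinear_map sU sV sW f" "Vector_Spaces.linear sX sU T"
  shows "bilinear_map sX sV sW (\<lambda>x v. f (T x) v)"
  using assms Vector_Spaces.linear_compose[of sX sU T sW] by (auto simp: bilinear_map_def o_def)

lemma bilinear_map_comp_right:
  assumes "bilinear_map sU sV sW f" "Vector_Spaces.linear sX sV T"
  shows "bilinear_map sU sX sW (\<lambda>u x. f u (T x))"
  using assms Vector_Spaces.linear_compose[of sX sV T sW] by (auto simp: bilinear_map_def o_def)

text \<open>In \<open>dl_bar\<close> and \<open>dr_bar\<close> the two products occur only under
  \<open>P\<close>, which does not distinguish them; the other identities are the bimodule laws of M
  over A.\<close>

lemma (in rel_averaging_algebra) diassoc_algebra_induced:
  "diassoc_algebra sM (induced_dl rM P) (induced_dr lM P)"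
proof unfold_locales
  show "bilinear_map sM sM sM (induced_dl rM P)"
    unfolding induced_dl_def[abs_def]
    by (rule bilinear_map_comp_right[OF bilinear_ract linear_P])
  show "bilinear_map sM sM sM (induced_dr lM P)"
    unfolding induced_dr_def[abs_def]
    by (rule bilinear_map_comp_left[OF bilinear_lact linear_P])
qed (simp_all add: induced_dl_def induced_dr_def lact_mul lact_ract ract_mul
       flip: averaging_left averaging_right)

lemma (in rel_averaging_bimodule) diassoc_representation_induced:
  "diassoc_representation
     sM (induced_dl rM P) (induced_dr lM P)
     sN (\<lambda>u n. l u (Q n)) (\<lambda>u n. lN (P u) n) (\<lambda>n u. rN n (P u)) (\<lambda>n u. r (Q n) u)"
proof -
  \<comment> \<open>This discharges the axioms of the acting algebra, so that
    \<open>unfold_locales\<close> leaves only the bilinearity of the four actions and the fifteen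
    mixed identities.\<close>
  interpret D: diassoc_algebra sM "induced_dl rM P" "induced_dr lM P"
    by (rule base.diassoc_algebra_induced)
  show ?thesis
  proof unfold_locales
    show "bilinear_map sM sN sN (\<lambda>u n. l u (Q n))"
      by (rule bilinear_map_comp_right[OF bilinear_l linear_Q])
    show "bilinear_map sM sN sN (\<lambda>u n. lN (P u) n)"
      by (rule bilinear_map_comp_left[OF N.bilinear_lact base.linear_P])
    show "bilinear_map sN sM sN (\<lambda>n u. rN n (P u))"
      by (rule bilinear_map_comp_right[OF N.bilinear_ract base.linear_P])
    show "bilinear_map sN sM sN (\<lambda>n u. r (Q n) u)"
      by (rule bilinear_map_comp_left[OF bilinear_r linear_Q])
  \<comment> \<open>The flipped equations rewrite \<open>P\<close> or \<open>Q\<close> of a product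
    to a product of images. For example, both sides of \<open>dl_dl_3\<close> become
    \<open>l a (lB (P b) (Q x))\<close>, by \<open>l_mid\<close> on the left and by
    \<open>P_Q_l\<close> on the right.\<close>
  qed (simp_all add: induced_dl_def induced_dr_def N.lact_mul N.lact_ract N.ract_mul
         l_lact l_mid l_ract r_lact r_mid r_ract
         flip: base.averaging_left base.averaging_right P_Q_lact P_Q_l Q_P_r Q_P_ract)
qed

theorem proposition3p25:
  fixes sA :: "'k :: field_char_0 \<Rightarrow> 'a :: ab_group_add \<Rightarrow> 'a"
    and mulA :: "'a \<Rightarrow> 'a \<Rightarrow> 'a"
    and sM :: "'k \<Rightarrow> 'm :: ab_group_add \<Rightarrow> 'm"
    and lM :: "'a \<Rightarrow> 'm \<Rightarrow> 'm" and rM :: "'m \<Rightarrow> 'a \<Rightarrow> 'm"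
    and P :: "'m \<Rightarrow> 'a"
    and sN :: "'k \<Rightarrow> 'n :: ab_group_add \<Rightarrow> 'n"
    and lN :: "'a \<Rightarrow> 'n \<Rightarrow> 'n" and rN :: "'n \<Rightarrow> 'a \<Rightarrow> 'n"
    and sB :: "'k \<Rightarrow> 'b :: ab_group_add \<Rightarrow> 'b"
    and lB :: "'a \<Rightarrow> 'b \<Rightarrow> 'b" and rB :: "'b \<Rightarrow> 'a \<Rightarrow> 'b"
    and Q :: "'n \<Rightarrow> 'b"
    and l :: "'m \<Rightarrow> 'b \<Rightarrow> 'n" and r :: "'b \<Rightarrow> 'm \<Rightarrow> 'n"
  assumes "rel_averaging_algebra sA mulA sM lM rM P"
    and "rel_averaging_bimodule sA mulA sM lM rM P sN lN rN sB lB rB Q l r"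
  shows "diassoc_representation
           sM (induced_dl rM P) (induced_dr lM P)
           sN (\<lambda>u n. l u (Q n)) (\<lambda>u n. lN (P u) n) (\<lambda>n u. rN n (P u)) (\<lambda>n u. r (Q n) u)"
  using assms(2) by (rule rel_averaging_bimodule.diassoc_representation_induced)

end
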